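(* Let $F(x)=\mathbb{E}[F(x;\xi)]$ satisfy the basic assumptions (i)–(iv) of the context, and let the weak linear regularity property hold with $\beta=0$, i.e. there are constants $\sigma_{F,\mu}>0$, nonincreasing in $\mu$, such that for any $\mu>0$, $\frac{\sigma_{F,\mu}}{2}\mathrm{dist}_{X^*}^2(x)\le F_\mu(x)-F_\mu^*$ for all $x\in\mathbb{R}^n$. Assume also that the functional components share common minimizers: for any $x^*\in X^*$, $0\in\partial F(x^*;\xi)$ for all $\xi\in\Omega$. Then the sequence $\{x^k\}_{k\ge0}$ generated by SPP with constant stepsize $\mu_k=\mu>0$ satisfies $$\mathbb{E}\left[\mathrm{dist}_{X^*}^2(x^k)\right]\le(1-\mu\sigma_{F,\mu})^k\,\mathbb{E}\left[\mathrm{dist}_{X^*}^2(x^0)\right].$$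
   Context: Setting. $\xi$ is a random variable with probability space $(\Omega,\mathbb{P})$. For each $\xi$, $F(\cdot;\xi):\mathbb{R}^n\to(-\infty,+\infty]$ is proper, convex and lower semicontinuous. $F(x)=\mathbb{E}[F(x;\xi)]$, $F^*=\min_{x\in\mathbb{R}^n}F(x)$, $X^*=\arg\min F$. $\|\cdot\|$ is the Euclidean norm and $\mathrm{dist}_X(x)=\min_{z\in X}\|x-z\|$. Moreau envelope and prox. For $\mu>0$: $F_\mu(x;\xi)=\min_{z}F(z;\xi)+\frac{1}{2\mu}\|z-x\|^2$, $z_\mu(x;\xi)=\arg\min_z F(z;\xi)+\frac{1}{2\mu}\|z-x\|^2$, $F_\mu(x)=\mathbb{E}[F_\mu(x;\xi)]$, $F_\mu^*=\min_x F_\mu(x)$. Basic assumptions. (i) $X^*\neq\emptyset$. (ii) There is a subgradient mapping $g_F:\mathbb{R}^n\times\Omega\to\mathbb{R}^n$ with $g_F(x;\xi)\in\partial F(x;\xi)$ for all $\xi\in\Omega$ and $\mathbb{E}[g_F(x;\xi)]\in\partial F(x)$. (iii) There exists $\mathcal{S}_F^*\ge 0$ such that $\mathbb{E}[\|g_F(x^*;\xi)\|^2]\le\mathcal{S}_F^*<\infty$ for all $x^*\in X^*$. (iv) For any $x^*\in X^*$ and any $g_F(x^* )\in\partial F(x^* )$ there exist bounded subgradients $g_F(x^*;\xi)\in\partial F(x^*;\xi)$ such that $\mathbb{E}[g_F(x^*;\xi)]=g_F(x^* )$ and $\mathbb{E}[\|g_F(x^*;\xi)\|^2]<\mathcal{S}_F^*$;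 moreover the subgradients at $x^*$ are taken such that $g_F(x^* )=\mathbb{E}[g_F(x^*;\xi)]=0$. SPP algorithm with constant stepsize $\mu$. Given $x^0\in\mathbb{R}^n$, at each step $k$ choose $\xi_k\in\Omega$ randomly according to $\mathbb{P}$ (independently of the past) and set $x^{k+1}=z_{\mu}(x^k;\xi_k)$. *)

theory Defs
  imports "HOL-Probability.Probability"
begin

section \<open>Convex analysis of extended-real-valued functions\<close>

definition proper_fun :: "('a \<Rightarrow> ereal) \<Rightarrow> bool" where
  "proper_fun f \<longleftrightarrow> (\<forall>x. f x \<noteq> - \<infinity>) \<and> (\<exists>x. f x \<noteq> \<infinity>)"

text \<open>The library's \<open>epigraph\<close> and \<open>convex_on\<close> cover real-valued functions only.\<close>

definition ereal_epigraph :: "('a \<Rightarrow> ereal) \<Rightarrow> ('a \<times> real) set" where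
  "ereal_epigraph f = {(x, t). f x \<le> ereal t}"

definition convex_fun :: "('a::real_vector \<Rightarrow> ereal) \<Rightarrow> bool" where
  "convex_fun f \<longleftrightarrow> convex (ereal_epigraph f)"

definition lower_semicont :: "('a::topological_space \<Rightarrow> ereal) \<Rightarrow> bool" where
  "lower_semicont f \<longleftrightarrow> (\<forall>x. f x \<le> Liminf (at x) f)"

text \<open>For proper \<open>f\<close> this set is empty wherever \<open>f x = \<infinity>\<close>.\<close>

definition subdifferential :: "('a::real_inner \<Rightarrow> ereal) \<Rightarrow> 'a \<Rightarrow> 'a set" where
  "subdifferential f x = {g. \<forall>y. f x + ereal (g \<bullet> (y - x)) \<le> f y}"

definition argmin_set :: "('a \<Rightarrow> ereal) \<Rightarrow> 'a set" where
  "argmin_set f = {x. is_arg_min f (\<lambda>_. True) x}"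

definition moreau_envelope :: "real \<Rightarrow> ('a::euclidean_space \<Rightarrow> ereal) \<Rightarrow> 'a \<Rightarrow> ereal" where
  "moreau_envelope \<mu> f x = (INF z. f z + ereal ((norm (z - x))\<^sup>2 / (2 * \<mu>)))"

definition prox :: "real \<Rightarrow> ('a::euclidean_space \<Rightarrow> ereal) \<Rightarrow> 'a \<Rightarrow> 'a" where
  "prox \<mu> f x = arg_min (\<lambda>z. f z + ereal ((norm (z - x))\<^sup>2 / (2 * \<mu>))) (\<lambda>_. True)"


section \<open>Expectations of random functions\<close>

text \<open>
  Expectation of a random variable with values in \<open>[-\<infinity>, \<infinity>]\<close>. As \<open>\<infinity> - \<infinity> = \<infinity>\<close> in
  \<open>ereal\<close>, it is \<open>\<infinity>\<close> if both the positive and the negative part have infinite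
  expectation, the usual convention for integral functionals in convex analysis.
\<close>

definition ereal_expectation :: "'w measure \<Rightarrow> ('w \<Rightarrow> ereal) \<Rightarrow> ereal" where
  "ereal_expectation M X =
     enn2ereal (\<integral>\<^sup>+ w. e2ennreal (X w) \<partial>M) - enn2ereal (\<integral>\<^sup>+ w. e2ennreal (- X w) \<partial>M)"

definition expected_fun :: "'w measure \<Rightarrow> ('a \<Rightarrow> 'w \<Rightarrow> ereal) \<Rightarrow> 'a \<Rightarrow> ereal" where
  "expected_fun M F x = ereal_expectation M (\<lambda>w. F x w)"

definition expected_envelope ::
    "'w measure \<Rightarrow> ('a::euclidean_space \<Rightarrow> 'w \<Rightarrow> ereal) \<Rightarrow> real \<Rightarrow> 'a \<Rightarrow> ereal" where
  "expected_envelope M F \<mu> x = ereal_expectation M (\<lambda>w. moreau_envelope \<mu> (\<lambda>z. F z w) x)"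

text \<open>
  Measurability of the epigraph mapping, i.e. \<open>F\<close> is a normal integrand (Rockafellar and Wets,
  Variational Analysis, Chapter 14). For components that are finite and convex this amounts to
  measurability of \<open>F x\<close> for each \<open>x\<close>; in the extended-valued case it is the standard condition
  under which \<open>F x\<close>, the Moreau envelope and the proximal point are random variables.
\<close>

definition measurable_epigraph ::
    "'w measure \<Rightarrow> ('a::euclidean_space \<Rightarrow> 'w \<Rightarrow> ereal) \<Rightarrow> bool" where
  "measurable_epigraph M F \<longleftrightarrow>
     (\<forall>U. open U \<longrightarrow> {w \<in> space M. ereal_epigraph (\<lambda>x. F x w) \<inter> U \<noteq> {}} \<in> sets M)"

definition convex_random_function ::
    "'w measure \<Rightarrow> ('a::euclidean_space \<Rightarrow> 'w \<Rightarrow> ereal) \<Rightarrow> bool" where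
  "convex_random_function M F \<longleftrightarrow>
     (\<forall>w\<in>space M. proper_fun (\<lambda>x. F x w) \<and> convex_fun (\<lambda>x. F x w) \<and> lower_semicont (\<lambda>x. F x w)) \<and>
     measurable_epigraph M F \<and>
     proper_fun (expected_fun M F)"

text \<open>
  In the second clause subgradients are demanded only on the domain of the expected function,
  since the components may take the value \<open>\<infinity>\<close>, where there is no subgradient.
\<close>

definition basic_assumptions ::
    "'w measure \<Rightarrow> ('a::euclidean_space \<Rightarrow> 'w \<Rightarrow> ereal) \<Rightarrow> ('a \<Rightarrow> 'w \<Rightarrow> 'a) \<Rightarrow> real \<Rightarrow> bool" where
  "basic_assumptions M F g S \<longleftrightarrow>
     argmin_set (expected_fun M F) \<noteq> {} \<and>
     (\<forall>x. expected_fun M F x < \<infinity> \<longrightarrow>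
        (\<forall>w\<in>space M. g x w \<in> subdifferential (\<lambda>z. F z w) x) \<and>
        integrable M (g x) \<and> (\<integral>w. g x w \<partial>M) \<in> subdifferential (expected_fun M F) x) \<and>
     0 \<le> S \<and>
     (\<forall>xs\<in>argmin_set (expected_fun M F).
        integrable M (\<lambda>w. (norm (g xs w))\<^sup>2) \<and> (\<integral>w. (norm (g xs w))\<^sup>2 \<partial>M) \<le> S) \<and>
     (\<forall>xs\<in>argmin_set (expected_fun M F). \<forall>v\<in>subdifferential (expected_fun M F) xs.
        \<exists>h. (\<forall>w\<in>space M. h w \<in> subdifferential (\<lambda>z. F z w) xs) \<and>
            bounded (h ` space M) \<and>
            integrable M h \<and> (\<integral>w. h w \<partial>M) = v \<and>
            integrable M (\<lambda>w. (norm (h w))\<^sup>2) \<and> (\<integral>w. (norm (h w))\<^sup>2 \<partial>M) < S) \<and>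
     (\<forall>xs\<in>argmin_set (expected_fun M F). (\<integral>w. g xs w \<partial>M) = 0)"


section \<open>The stochastic proximal point algorithm\<close>

text \<open>Independence as in the library's \<open>indep_var\<close>, but for variables of different types.\<close>

definition indep_random_vars ::
    "'p measure \<Rightarrow> 'b measure \<Rightarrow> ('p \<Rightarrow> 'b) \<Rightarrow> 'c measure \<Rightarrow> ('p \<Rightarrow> 'c) \<Rightarrow> bool" where
  "indep_random_vars P M1 X M2 Y \<longleftrightarrow>
     X \<in> measurable P M1 \<and> Y \<in> measurable P M2 \<and>
     prob_space.indep_set P {X -` A \<inter> space P |A. A \<in> sets M1} {Y -` B \<inter> space P |B. B \<in> sets M2}"

text \<open>
  The iterates live on a probability space \<open>P\<close> carrying the samples \<open>\<xi> k\<close>. Each sample has law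
  \<open>M\<close> and is independent of the initial point and all earlier samples. The initial point may be
  random; a deterministic one is the case of a constant \<open>x 0\<close>.
\<close>

definition spp_sequence ::
    "'p measure \<Rightarrow> 'w measure \<Rightarrow> ('a::euclidean_space \<Rightarrow> 'w \<Rightarrow> ereal) \<Rightarrow> real \<Rightarrow>
     (nat \<Rightarrow> 'p \<Rightarrow> 'w) \<Rightarrow> (nat \<Rightarrow> 'p \<Rightarrow> 'a) \<Rightarrow> bool" where
  "spp_sequence P M F \<mu> \<xi> x \<longleftrightarrow>
     prob_space P \<and>
     (\<forall>k. distr P M (\<xi> k) = M) \<and>
     (\<forall>k. indep_random_vars P
            (borel \<Otimes>\<^sub>M PiM {..<k} (\<lambda>_. M)) (\<lambda>\<omega>. (x 0 \<omega>, \<lambda>i\<in>{..<k}. \<xi> i \<omega>))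
            M (\<xi> k)) \<and>
     (\<forall>k. \<forall>\<omega>\<in>space P. x (Suc k) \<omega> = prox \<mu> (\<lambda>z. F z (\<xi> k \<omega>)) (x k \<omega>))"

end

theory Submission
  imports Defs
begin

text \<open>
  Fix \<open>w\<close> and let \<open>p\<close> be the proximal point of \<open>f = F \<cdot> w\<close> at \<open>x\<close>. The function
  \<open>z \<mapsto> f z + \<parallel>z - x\<parallel>\<^sup>2 / (2 * \<mu>)\<close> is strongly convex and minimal at \<open>p\<close>, with value the Moreau
  envelope \<open>e\<close>, so it exceeds \<open>e\<close> by at least \<open>\<parallel>z - p\<parallel>\<^sup>2 / (2 * \<mu>)\<close>
  (\<open>prox_quadratic_growth\<close>). At a solution \<open>xs\<close>, which minimizes every component, this reads
  \<open>\<parallel>xs - p\<parallel>\<^sup>2 + 2 * \<mu> * (e - min f) \<le> \<parallel>xs - x\<parallel>\<^sup>2\<close>, and taking the infimum over \<open>xs\<close> turns the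
  norms into distances to the solution set (\<open>infdist_prox\<close>).

  The envelope lies above \<open>min f\<close> everywhere, so the expectation of \<open>min f\<close> is a lower bound for
  the infimum of the expected envelope. Hence the expectation of the gap \<open>e - min f\<close> is at least the excess of
  the expected envelope over that infimum. Weak linear regularity bounds that excess from
  below, and averaging over \<open>w\<close> contracts the squared distance by \<open>1 - \<mu> * \<sigma> \<mu>\<close>
  (\<open>expected_prox_step\<close>).

  To apply this along the iteration, \<open>\<xi> k\<close> has to be integrated out with \<open>x k\<close> held fixed. The
  iterate \<open>x k\<close> is a measurable function of the initial point and the earlier samples, which
  are independent of \<open>\<xi> k\<close>, so Fubini applies (\<open>spp_expected_step\<close>). That function is a
  composition of proximal maps, whence the need for measurability of the proximal point
  jointly in the base point and the sample (\<open>prox_measurable\<close>).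
\<close>

section \<open>The proximal point of a convex function\<close>

lemma closed_ereal_epigraph:
  fixes f :: "'a::topological_space \<Rightarrow> ereal"
  assumes "lower_semicont f"
  shows "closed (ereal_epigraph f)"
  unfolding closed_def
proof (subst open_subopen, intro ballI)
  fix p assume "p \<in> - ereal_epigraph f"
  then obtain x t where p: "p = (x, t)" and "ereal t < f x"
    by (cases p) (auto simp: ereal_epigraph_def)
  then obtain t' where t': "ereal t < ereal t'" "ereal t' < f x"
    using ereal_dense2 by blast
  have "f x \<le> Liminf (at x) f"
    using assms by (simp add: lower_semicont_def)
  then have "eventually (\<lambda>y. ereal t' < f y) (at x)"
    using t'(2) by (auto simp: le_Liminf_iff)
  then obtain U where U: "open U" "x \<in> U" "\<And>y. y \<in> U \<Longrightarrow> y \<noteq> x \<Longrightarrow> ereal t' < f y"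
    unfolding eventually_at_topological by blast
  have "U \<times> {..<t'} \<subseteq> - ereal_epigraph f"
  proof safe
    fix y s assume "y \<in> U" "s < t'" "(y, s) \<in> ereal_epigraph f"
    then have "f y < ereal t'"
      by (auto simp: ereal_epigraph_def intro: le_less_trans)
    then show False
      using U(3)[OF \<open>y \<in> U\<close>] t'(2) by (cases "y = x") auto
  qed
  then show "\<exists>T. open T \<and> p \<in> T \<and> T \<subseteq> - ereal_epigraph f"
    using U t' by (intro exI[of _ "U \<times> {..<t'}"]) (auto simp: p intro: open_Times)
qed

text \<open>
  Compare the minimizer \<open>z\<close> with the point at parameter \<open>l\<close> of the segment to \<open>y\<close>. Convexity of \<open>f\<close>
  and the identity for the squared norm of a convex combination bound the objective there from
  above by the interpolated values minus \<open>l * (1 - l) * \<parallel>y - z\<parallel>\<^sup>2 / (2 * \<mu>)\<close>; divide by \<open>l\<close> and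
  let \<open>l\<close> tend to \<open>0\<close>. Working with points of the epigraph keeps all quantities real.
\<close>

lemma convex_epigraph_minimizer_quadratic_growth:
  fixes f :: "'a::real_inner \<Rightarrow> ereal"
  assumes "convex_fun f" and "\<mu> > 0"
    and z: "(z, s) \<in> ereal_epigraph f"
    and min: "\<And>y r. (y, r) \<in> ereal_epigraph f \<Longrightarrow>
                s + (norm (z - x))\<^sup>2 / (2 * \<mu>) \<le> r + (norm (y - x))\<^sup>2 / (2 * \<mu>)"
    and y: "(y, r) \<in> ereal_epigraph f"
  shows "s + (norm (z - x))\<^sup>2 / (2 * \<mu>) + (norm (y - z))\<^sup>2 / (2 * \<mu>)
           \<le> r + (norm (y - x))\<^sup>2 / (2 * \<mu>)"
proof -
  let ?q = "\<lambda>v::'a. (norm v)\<^sup>2 / (2 * \<mu>)"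
  have chord: "s + ?q (z - x) + (1 - l) * ?q (y - z) \<le> r + ?q (y - x)" if l: "0 < l" "l < 1" for l
  proof -
    let ?p = "(1 - l) *\<^sub>R z + l *\<^sub>R y"
    have "(1 - l) *\<^sub>R (z, s) + l *\<^sub>R (y, r) \<in> ereal_epigraph f"
      using assms(1) z y l unfolding convex_fun_def by (intro convexD) auto
    then have "(?p, (1 - l) * s + l * r) \<in> ereal_epigraph f"
      by simp
    from min[OF this]
    have le: "s + ?q (z - x) \<le> (1 - l) * s + l * r + ?q (?p - x)" .
    have "(norm (?p - x))\<^sup>2
            = (1 - l) * (norm (z - x))\<^sup>2 + l * (norm (y - x))\<^sup>2 - l * (1 - l) * (norm (y - z))\<^sup>2"
      unfolding power2_norm_eq_inner
      by (simp add: inner_simps inner_commute algebra_simps power2_eq_square)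
    then have "?q (?p - x) = (1 - l) * ?q (z - x) + l * ?q (y - x) - l * (1 - l) * ?q (y - z)"
      by (simp add: add_divide_distrib diff_divide_distrib)
    moreover have "l * (s + A + (1 - l) * C) \<le> l * (r + B)"
      if "s + A \<le> (1 - l) * s + l * r + D" "D = (1 - l) * A + l * B - l * (1 - l) * C" for A B C D
      using that by (simp add: algebra_simps)
    ultimately have "l * (s + ?q (z - x) + (1 - l) * ?q (y - z)) \<le> l * (r + ?q (y - x))"
      using le by blast
    then show ?thesis
      using l by (simp only: mult_le_cancel_left_pos)
  qed
  have "((\<lambda>l. s + ?q (z - x) + (1 - l) * ?q (y - z)) \<longlongrightarrow> s + ?q (z - x) + (1 - 0) * ?q (y - z))
          (at_right 0)"
    by (intro tendsto_intros)
  moreover have "eventually (\<lambda>l. s + ?q (z - x) + (1 - l) * ?q (y - z) \<le> r + ?q (y - x))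
                   (at_right (0::real))"
    using chord unfolding eventually_at_right_field by (intro exI[of _ 1]) auto
  ultimately have "s + ?q (z - x) + (1 - 0) * ?q (y - z) \<le> r + ?q (y - x)"
    by (rule tendsto_upperbound) simp
  then show ?thesis by simp
qed

text \<open>
  On the closed epigraph the objective is the continuous function
  \<open>(z, s) \<mapsto> s + \<parallel>z - x\<parallel>\<^sup>2 / (2 * \<mu>)\<close>, whose sublevel sets there are compact by the lower bound
  on \<open>f\<close>.
\<close>

lemma epigraph_quadratic_minimizer_exists:
  fixes f :: "'a::euclidean_space \<Rightarrow> ereal"
  assumes "proper_fun f" "lower_semicont f" "\<mu> > 0" and c: "\<And>z. ereal c \<le> f z"
  obtains z s where "(z, s) \<in> ereal_epigraph f"
    and "\<And>y r. (y, r) \<in> ereal_epigraph f \<Longrightarrow>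
           s + (norm (z - x))\<^sup>2 / (2 * \<mu>) \<le> r + (norm (y - x))\<^sup>2 / (2 * \<mu>)"
proof -
  let ?h = "\<lambda>p::'a \<times> real. snd p + (norm (fst p - x))\<^sup>2 / (2 * \<mu>)"
  have cont: "continuous_on UNIV ?h"
    using \<open>\<mu> > 0\<close> by (intro continuous_intros) auto
  obtain z0 where "f z0 \<noteq> \<infinity>" "f z0 \<noteq> -\<infinity>"
    using assms(1) by (auto simp: proper_fun_def)
  then obtain s0 where p0: "(z0, s0) \<in> ereal_epigraph f"
    by (cases "f z0") (auto simp: ereal_epigraph_def)
  define h0 where "h0 = ?h (z0, s0)"
  define K where "K = ereal_epigraph f \<inter> {p. ?h p \<le> h0}"
  have bound: "norm (z - x) \<le> sqrt (2 * \<mu> * (h0 - c)) \<and> c \<le> s \<and> s \<le> h0" if "(z, s) \<in> K" for z s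
  proof -
    have "ereal c \<le> ereal s"
      using that order_trans[OF c[of z]] unfolding K_def ereal_epigraph_def by blast
    moreover have le: "s + (norm (z - x))\<^sup>2 / (2 * \<mu>) \<le> h0"
      using that by (auto simp: K_def)
    moreover have "0 \<le> (norm (z - x))\<^sup>2 / (2 * \<mu>)"
      using \<open>\<mu> > 0\<close> by simp
    ultimately have "c \<le> s" "s \<le> h0" "(norm (z - x))\<^sup>2 / (2 * \<mu>) \<le> h0 - c"
      by auto
    then show ?thesis
      using \<open>\<mu> > 0\<close> by (auto intro!: real_le_rsqrt simp: field_simps)
  qed
  have "K \<subseteq> cball x (sqrt (2 * \<mu> * (h0 - c))) \<times> {c..h0}"
    using bound by (auto simp: dist_norm norm_minus_commute)
  then have "bounded K"
    by (rule bounded_subset[rotated]) (intro bounded_Times bounded_cball bounded_closed_interval)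
  moreover have "closed K"
    unfolding K_def using closed_ereal_epigraph[OF assms(2)] cont
    by (intro closed_Int closed_Collect_le) auto
  moreover have "(z0, s0) \<in> K"
    using p0 by (simp add: K_def h0_def)
  ultimately have "compact K" "K \<noteq> {}"
    by (auto simp: compact_eq_bounded_closed)
  from continuous_attains_inf[OF this continuous_on_subset[OF cont subset_UNIV]]
  obtain p where p: "p \<in> K" "\<And>q. q \<in> K \<Longrightarrow> ?h p \<le> ?h q"
    by blast
  have "?h p \<le> ?h q" if "q \<in> ereal_epigraph f" for q
    using p(2)[of q] p(1) that by (cases "?h q \<le> h0") (auto simp: K_def)
  with p(1) show thesis
    by (intro that[of "fst p" "snd p"]) (auto simp: K_def)
qed

text \<open>
  Collects the two preceding lemmas in terms of \<open>prox\<close> and \<open>moreau_envelope\<close>: \<open>prox\<close> is chosen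
  among the minimizers, so existence of one is what makes it a minimizer.
\<close>

lemma prox_quadratic_growth:
  fixes f :: "'a::euclidean_space \<Rightarrow> ereal"
  assumes "proper_fun f" "convex_fun f" "lower_semicont f" "\<mu> > 0" and c: "\<And>z. ereal c \<le> f z"
  obtains e where "moreau_envelope \<mu> f x = ereal e"
    and "f (prox \<mu> f x) + ereal ((norm (prox \<mu> f x - x))\<^sup>2 / (2 * \<mu>)) = ereal e"
    and "\<And>y r. f y \<le> ereal r \<Longrightarrow>
           e + (norm (y - prox \<mu> f x))\<^sup>2 / (2 * \<mu>) \<le> r + (norm (y - x))\<^sup>2 / (2 * \<mu>)"
proof -
  let ?\<phi> = "\<lambda>z. f z + ereal ((norm (z - x))\<^sup>2 / (2 * \<mu>))"
  obtain z s where z: "(z, s) \<in> ereal_epigraph f"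
    and min: "\<And>y r. (y, r) \<in> ereal_epigraph f \<Longrightarrow>
           s + (norm (z - x))\<^sup>2 / (2 * \<mu>) \<le> r + (norm (y - x))\<^sup>2 / (2 * \<mu>)"
    using epigraph_quadratic_minimizer_exists[OF assms(1,3,4) c, where x = x] by blast
  define e where "e = s + (norm (z - x))\<^sup>2 / (2 * \<mu>)"
  have lower: "ereal e \<le> ?\<phi> y" for y
  proof (cases "f y")
    case (real r)
    then have "(y, r) \<in> ereal_epigraph f"
      by (simp add: ereal_epigraph_def)
    from min[OF this] show ?thesis
      by (simp add: real e_def)
  qed (use assms(1) in \<open>auto simp: proper_fun_def\<close>)
  have upper: "?\<phi> z \<le> ereal e"
    using z add_right_mono[of "f z" "ereal s" "ereal ((norm (z - x))\<^sup>2 / (2 * \<mu>))"]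
    by (simp add: ereal_epigraph_def e_def)
  have "is_arg_min ?\<phi> (\<lambda>_. True) z"
    using lower upper by (auto simp: is_arg_min_def not_less intro: order_trans)
  then have "is_arg_min ?\<phi> (\<lambda>_. True) (prox \<mu> f x)"
    unfolding prox_def arg_min_def by (rule someI)
  then have "?\<phi> (prox \<mu> f x) \<le> ereal e"
    using upper by (auto simp: is_arg_min_def not_less intro: order_trans)
  with lower have attained: "?\<phi> (prox \<mu> f x) = ereal e"
    by (intro antisym)
  have envelope: "moreau_envelope \<mu> f x = ereal e"
    unfolding moreau_envelope_def
    using lower attained by (intro antisym INF_greatest) (auto intro!: INF_lower2[of "prox \<mu> f x"])
  define s' where "s' = e - (norm (prox \<mu> f x - x))\<^sup>2 / (2 * \<mu>)"
  have "f (prox \<mu> f x) = ereal s'"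
    using attained by (cases "f (prox \<mu> f x)") (auto simp: s'_def)
  then have "(prox \<mu> f x, s') \<in> ereal_epigraph f"
    by (simp add: ereal_epigraph_def)
  from convex_epigraph_minimizer_quadratic_growth[OF assms(2,4) this, of x]
  have "e + (norm (y - prox \<mu> f x))\<^sup>2 / (2 * \<mu>) \<le> r + (norm (y - x))\<^sup>2 / (2 * \<mu>)"
    if "f y \<le> ereal r" for y r
    using min that unfolding s'_def e_def by (simp add: ereal_epigraph_def)
  with envelope attained show thesis
    by (rule that)
qed

text \<open>
  The right-hand side says that the epigraph meets an open set, which is the kind of event that
  \<open>measurable_epigraph\<close> controls.
\<close>

lemma moreau_envelope_less_iff:
  fixes f :: "'a::euclidean_space \<Rightarrow> ereal"
  assumes proper: "\<And>z. f z \<noteq> -\<infinity>"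
  shows "moreau_envelope \<mu> f x < ereal a \<longleftrightarrow>
     (\<exists>(z, r)\<in>ereal_epigraph f. r + (norm (z - x))\<^sup>2 / (2 * \<mu>) < a)"
proof
  assume "moreau_envelope \<mu> f x < ereal a"
  then obtain z where z: "f z + ereal ((norm (z - x))\<^sup>2 / (2 * \<mu>)) < ereal a"
    by (auto simp: moreau_envelope_def INF_less_iff)
  then obtain r where "f z = ereal r"
    using proper[of z] by (cases "f z") auto
  with z show "\<exists>(z, r)\<in>ereal_epigraph f. r + (norm (z - x))\<^sup>2 / (2 * \<mu>) < a"
    by (intro bexI[of _ "(z, r)"]) (auto simp: ereal_epigraph_def)
next
  assume "\<exists>(z, r)\<in>ereal_epigraph f. r + (norm (z - x))\<^sup>2 / (2 * \<mu>) < a"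
  then obtain z r where zr: "f z \<le> ereal r" "r + (norm (z - x))\<^sup>2 / (2 * \<mu>) < a"
    by (auto simp: ereal_epigraph_def)
  have "moreau_envelope \<mu> f x \<le> f z + ereal ((norm (z - x))\<^sup>2 / (2 * \<mu>))"
    unfolding moreau_envelope_def by (rule INF_lower) simp
  also have "\<dots> \<le> ereal r + ereal ((norm (z - x))\<^sup>2 / (2 * \<mu>))"
    using zr(1) by (rule add_right_mono)
  also have "\<dots> < ereal a"
    using zr(2) by simp
  finally show "moreau_envelope \<mu> f x < ereal a" .
qed

section \<open>Measurability of the proximal point\<close>

text \<open>
  A parametric form of \<open>measurable_epigraph\<close>: the open set may depend on a parameter. It is
  a countable union of open boxes \<open>A \<times> B\<close>, and for each box the condition on the parameter and
  the condition on the sample separate into a measurable rectangle.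
\<close>

lemma epigraph_hitting_set_measurable:
  fixes F :: "'a::euclidean_space \<Rightarrow> 'w \<Rightarrow> ereal" and G :: "('b::second_countable_topology \<times> 'a \<times> real) set"
  assumes "measurable_epigraph M F" "open G"
  shows "{v \<in> space (borel \<Otimes>\<^sub>M M). \<exists>p\<in>ereal_epigraph (\<lambda>z. F z (snd v)). (fst v, p) \<in> G}
           \<in> sets (borel \<Otimes>\<^sub>M M)"
proof -
  obtain \<A> :: "'b set set" where \<A>: "countable \<A>" "topological_basis \<A>"
    using ex_countable_basis by blast
  obtain \<B> :: "('a \<times> real) set set" where \<B>: "countable \<B>" "topological_basis \<B>"
    using ex_countable_basis by blast
  define hit where "hit B = {w \<in> space M. ereal_epigraph (\<lambda>z. F z w) \<inter> B \<noteq> {}}" for B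
  define I where "I = {(A, B) \<in> \<A> \<times> \<B>. A \<times> B \<subseteq> G}"
  have "{v \<in> space (borel \<Otimes>\<^sub>M M). \<exists>p\<in>ereal_epigraph (\<lambda>z. F z (snd v)). (fst v, p) \<in> G}
          = (\<Union>(A, B)\<in>I. A \<times> hit B)" (is "?L = ?R")
  proof
    show "?L \<subseteq> ?R"
    proof
      fix v assume "v \<in> ?L"
      then obtain p where w: "snd v \<in> space M" and p: "p \<in> ereal_epigraph (\<lambda>z. F z (snd v))"
        and "(fst v, p) \<in> G"
        by (auto simp: space_pair_measure)
      then obtain A B where AB: "open A" "open B" "fst v \<in> A" "p \<in> B" "A \<times> B \<subseteq> G"
        using open_prod_elim[OF assms(2)] by (metis mem_Sigma_iff)
      obtain A' where "A' \<in> \<A>" "fst v \<in> A'" "A' \<subseteq> A"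
        using topological_basisE[OF \<A>(2) AB(1,3)] .
      moreover obtain B' where "B' \<in> \<B>" "p \<in> B'" "B' \<subseteq> B"
        using topological_basisE[OF \<B>(2) AB(2,4)] .
      ultimately have "(A', B') \<in> I" "v \<in> A' \<times> hit B'"
        using AB(5) w p by (cases v; auto simp: I_def hit_def)+
      then show "v \<in> ?R" by blast
    qed
    show "?R \<subseteq> ?L"
      by (fastforce simp: I_def hit_def space_pair_measure)
  qed
  moreover have "countable I"
    using \<A>(1) \<B>(1) by (intro countable_subset[of I "\<A> \<times> \<B>"] countable_SIGMA) (auto simp: I_def)
  moreover have "A \<times> hit B \<in> sets (borel \<Otimes>\<^sub>M M)" if "(A, B) \<in> I" for A B
  proof -
    have "open A" "open B"
      using that \<A>(2) \<B>(2) by (auto simp: I_def topological_basis_open)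
    then show ?thesis
      using assms(1) by (auto simp: hit_def measurable_epigraph_def)
  qed
  ultimately show ?thesis
    by (auto intro!: sets.countable_UN'')
qed

text \<open>
  By strong convexity near-minimizers are close to the proximal point. Hence its coordinate along
  \<open>b\<close> is at most \<open>c\<close> iff every nonempty strict sublevel set of the objective contains
  points with coordinate below \<open>c + \<epsilon>\<close>, for each \<open>\<epsilon> > 0\<close>. It suffices to test rational levels and
  \<open>\<epsilon> = 1 / (n + 1)\<close>, and each test asks whether the epigraph meets an open set.
\<close>

lemma prox_measurable:
  fixes F :: "'a::euclidean_space \<Rightarrow> 'w \<Rightarrow> ereal"
  assumes meas: "measurable_epigraph M F" and "\<mu> > 0"
    and F: "\<And>w. w \<in> space M \<Longrightarrow>
              proper_fun (\<lambda>z. F z w) \<and> convex_fun (\<lambda>z. F z w) \<and> lower_semicont (\<lambda>z. F z w)"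
    and bdd: "\<And>w. w \<in> space M \<Longrightarrow> \<exists>c. \<forall>z. ereal c \<le> F z w"
  shows "(\<lambda>(x, w). prox \<mu> (\<lambda>z. F z w) x) \<in> borel_measurable (borel \<Otimes>\<^sub>M M)"
proof (subst borel_measurable_euclidean_space, intro ballI, subst borel_measurable_iff_le, intro allI)
  fix b :: 'a and c :: real assume b: "b \<in> Basis"
  let ?p = "\<lambda>v. prox \<mu> (\<lambda>z. F z (snd v)) (fst v)"
  define G where "G t = {(x::'a, z, s). s + (norm (z - x))\<^sup>2 / (2 * \<mu>) < t}" for t :: real
  define H where "H \<epsilon> = {(x::'a, z, s::real). z \<bullet> b < c + \<epsilon>}" for \<epsilon>
  have G: "open (G t)" for t
    unfolding G_def case_prod_beta using \<open>\<mu> > 0\<close> by (intro open_Collect_less continuous_intros) auto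
  have H: "open (H \<epsilon>)" for \<epsilon>
    unfolding H_def case_prod_beta by (intro open_Collect_less continuous_intros)
  define hit where "hit U = {v \<in> space (borel \<Otimes>\<^sub>M M).
      \<exists>p\<in>ereal_epigraph (\<lambda>z. F z (snd v)). (fst v, p) \<in> U}" for U :: "('a \<times> 'a \<times> real) set"
  have hit: "hit U \<in> sets (borel \<Otimes>\<^sub>M M)" if "open U" for U
    unfolding hit_def by (rule epigraph_hitting_set_measurable[OF meas that])
  have char: "?p v \<bullet> b \<le> c \<longleftrightarrow>
      (\<forall>n::nat. \<forall>t\<in>\<rat>. v \<in> hit (G t) \<longrightarrow> v \<in> hit (G t \<inter> H (inverse (real (Suc n)))))" (is "_ \<longleftrightarrow> ?Q")
    if v: "v \<in> space (borel \<Otimes>\<^sub>M M)" for v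
  proof -
    obtain x w where xw: "v = (x, w)" "w \<in> space M"
      using v by (auto simp: space_pair_measure)
    obtain c' where c': "\<And>z. ereal c' \<le> F z w"
      using bdd[OF xw(2)] by blast
    obtain e where at: "F (?p v) w + ereal ((norm (?p v - x))\<^sup>2 / (2 * \<mu>)) = ereal e"
      and growth: "\<And>y r. F y w \<le> ereal r \<Longrightarrow>
           e + (norm (y - ?p v))\<^sup>2 / (2 * \<mu>) \<le> r + (norm (y - x))\<^sup>2 / (2 * \<mu>)"
      using prox_quadratic_growth[of "\<lambda>z. F z w" \<mu> c' x thesis] F[OF xw(2)] \<open>\<mu> > 0\<close> c'
      unfolding xw fst_conv snd_conv by blast
    define s where "s = e - (norm (?p v - x))\<^sup>2 / (2 * \<mu>)"
    have s: "F (?p v) w = ereal s"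
      using at by (cases "F (?p v) w") (auto simp: s_def)
    show ?thesis
    proof
      assume le: "?p v \<bullet> b \<le> c"
      show ?Q
      proof (intro allI ballI impI)
        fix n :: nat and t :: real assume "t \<in> \<rat>" "v \<in> hit (G t)"
        then obtain y r where yr: "F y w \<le> ereal r" "r + (norm (y - x))\<^sup>2 / (2 * \<mu>) < t"
          by (auto simp: hit_def G_def ereal_epigraph_def xw)
        have "0 \<le> (norm (y - ?p v))\<^sup>2 / (2 * \<mu>)"
          using \<open>\<mu> > 0\<close> by simp
        with growth[OF yr(1)] yr(2) have "e < t" by linarith
        then have "(x, ?p v, s) \<in> G t"
          by (simp add: G_def s_def)
        moreover have "(x, ?p v, s) \<in> H (inverse (real (Suc n)))"
          using le by (auto simp: H_def intro: le_less_trans)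
        ultimately show "v \<in> hit (G t \<inter> H (inverse (real (Suc n))))"
          using v s by (auto simp: hit_def ereal_epigraph_def xw intro!: exI[of _ "?p v"] exI[of _ s])
      qed
    next
      assume Q: ?Q
      show "?p v \<bullet> b \<le> c"
      proof (rule ccontr)
        assume "\<not> ?p v \<bullet> b \<le> c"
        define \<delta> where "\<delta> = (?p v \<bullet> b - c) / 2"
        have "\<delta> > 0"
          using \<open>\<not> ?p v \<bullet> b \<le> c\<close> by (simp add: \<delta>_def)
        then obtain n where n: "inverse (real (Suc n)) < \<delta>"
          using reals_Archimedean by blast
        \<comment> \<open>Points of the objective's sublevel set at this level lie within \<open>\<delta>\<close> of the proximal point.\<close>
        have "e < e + \<delta>\<^sup>2 / (2 * \<mu>)"
          using \<open>\<delta> > 0\<close> \<open>\<mu> > 0\<close> by simp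
        then obtain t where t: "t \<in> \<rat>" "e < t" "t < e + \<delta>\<^sup>2 / (2 * \<mu>)"
          using Rats_dense_in_real by blast
        have "v \<in> hit (G t)"
          using v s t(2) by (auto simp: hit_def G_def ereal_epigraph_def s_def xw
              intro!: exI[of _ "?p v"] exI[of _ s])
        with Q t(1) have "v \<in> hit (G t \<inter> H (inverse (real (Suc n))))"
          by blast
        then obtain y r where yr: "F y w \<le> ereal r" "r + (norm (y - x))\<^sup>2 / (2 * \<mu>) < t"
          "y \<bullet> b < c + inverse (real (Suc n))"
          by (auto simp: hit_def G_def H_def ereal_epigraph_def xw)
        have "(norm (y - ?p v))\<^sup>2 / (2 * \<mu>) < \<delta>\<^sup>2 / (2 * \<mu>)"
          using growth[OF yr(1)] yr(2) t(3) by linarith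
        then have "(norm (y - ?p v))\<^sup>2 < \<delta>\<^sup>2"
          using \<open>\<mu> > 0\<close> by (simp add: divide_less_cancel)
        then have "norm (y - ?p v) < \<delta>"
          using \<open>\<delta> > 0\<close> by (simp add: power_less_imp_less_base)
        moreover have "\<bar>(y - ?p v) \<bullet> b\<bar> \<le> norm (y - ?p v)"
          using b by (rule Basis_le_norm)
        ultimately have "?p v \<bullet> b - \<delta> < y \<bullet> b"
          by (simp add: inner_diff_left)
        moreover have "2 * \<delta> = ?p v \<bullet> b - c"
          by (simp add: \<delta>_def)
        ultimately show False
          using yr(3) n by linarith
      qed
    qed
  qed
  have "{v \<in> space (borel \<Otimes>\<^sub>M M). (case v of (x, w) \<Rightarrow> prox \<mu> (\<lambda>z. F z w) x) \<bullet> b \<le> c}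
      = {v \<in> space (borel \<Otimes>\<^sub>M M). ?p v \<bullet> b \<le> c}"
    by (simp add: case_prod_beta)
  also have "\<dots> = {v \<in> space (borel \<Otimes>\<^sub>M M).
      \<forall>n::nat. \<forall>t\<in>\<rat>. v \<in> hit (G t) \<longrightarrow> v \<in> hit (G t \<inter> H (inverse (real (Suc n))))}"
    using char by blast
  also have "\<dots> \<in> sets (borel \<Otimes>\<^sub>M M)"
  proof -
    have "{v \<in> space (borel \<Otimes>\<^sub>M M). v \<in> hit U} \<in> sets (borel \<Otimes>\<^sub>M M)" if "open U" for U
      using sets.Int[OF sets.top hit[OF that]] by (simp add: Int_def)
    from this[OF G] this[OF open_Int[OF G H]] show ?thesis
      by (intro sets.sets_Collect_countable_All sets.sets_Collect_countable_All'
          sets.sets_Collect_imp countable_rat)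
  qed
  finally show "{v \<in> space (borel \<Otimes>\<^sub>M M). (case v of (x, w) \<Rightarrow> prox \<mu> (\<lambda>z. F z w) x) \<bullet> b \<le> c}
      \<in> sets (borel \<Otimes>\<^sub>M M)" .
qed

section \<open>Families of components with common minimizers\<close>

lemma ereal_expectation_real:
  assumes "integrable M h" and "\<And>w. w \<in> space M \<Longrightarrow> X w = ereal (h w)"
  shows "ereal_expectation M X = ereal (\<integral>w. h w \<partial>M)"
proof -
  have "(\<integral>\<^sup>+ w. e2ennreal (X w) \<partial>M) = (\<integral>\<^sup>+ w. ennreal (h w) \<partial>M)"
    "(\<integral>\<^sup>+ w. e2ennreal (- X w) \<partial>M) = (\<integral>\<^sup>+ w. ennreal (- h w) \<partial>M)"
    using assms(2) by (auto intro!: nn_integral_cong)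
  moreover have "(\<integral>\<^sup>+ w. ennreal (h w) \<partial>M) \<noteq> \<infinity>" "(\<integral>\<^sup>+ w. ennreal (- h w) \<partial>M) \<noteq> \<infinity>"
    using assms(1) by (auto simp: real_integrable_def)
  ultimately show ?thesis
    using real_lebesgue_integral_def[OF assms(1)]
    unfolding ereal_expectation_def
    by (cases "\<integral>\<^sup>+ w. ennreal (h w) \<partial>M"; cases "\<integral>\<^sup>+ w. ennreal (- h w) \<partial>M") auto
qed

text \<open>
  \<open>X\<close> stands for the solution set. Finiteness of the expected function on \<open>X\<close> makes the minimal
  values of the components integrable, so that they can be subtracted under the expectation.
\<close>

locale interpolating_family = prob_space M for M :: "'w measure" +
  fixes F :: "'a::euclidean_space \<Rightarrow> 'w \<Rightarrow> ereal" and X :: "'a set"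
  assumes convex_random: "convex_random_function M F"
    and solution_exists: "X \<noteq> {}"
    and finite_at_solution: "xs \<in> X \<Longrightarrow> expected_fun M F xs < \<infinity>"
    and common_minimizer: "xs \<in> X \<Longrightarrow> w \<in> space M \<Longrightarrow> 0 \<in> subdifferential (\<lambda>z. F z w) xs"
begin

definition min_value :: "'w \<Rightarrow> real" where
  "min_value w = real_of_ereal (INF z. F z w)"

text \<open>
  The excess of the Moreau envelope over the minimum. It lies between \<open>0\<close> and
  \<open>(infdist x X)\<^sup>2 / (2 * \<mu>)\<close>, hence is integrable although the components need not be.
\<close>

definition envelope_gap :: "real \<Rightarrow> 'a \<Rightarrow> 'w \<Rightarrow> real" where
  "envelope_gap \<mu> x w = real_of_ereal (moreau_envelope \<mu> (\<lambda>z. F z w) x) - min_value w"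

lemma component_regular:
  assumes "w \<in> space M"
  shows "proper_fun (\<lambda>z. F z w)" "convex_fun (\<lambda>z. F z w)" "lower_semicont (\<lambda>z. F z w)"
  using convex_random assms by (auto simp: convex_random_function_def)

lemma value_at_solution:
  assumes "xs \<in> X" "w \<in> space M"
  shows "F xs w = ereal (min_value w)"
proof -
  have le: "F xs w \<le> F y w" for y
    using common_minimizer[OF assms] by (simp add: subdifferential_def zero_ereal_def[symmetric])
  then have "(INF z. F z w) = F xs w"
    by (intro antisym INF_lower INF_greatest) auto
  moreover have "F xs w \<noteq> \<infinity>" "F xs w \<noteq> -\<infinity>"
    using component_regular(1)[OF assms(2)] le by (auto simp: proper_fun_def)
  ultimately show ?thesis
    by (cases "F xs w") (auto simp: min_value_def)
qed

lemma min_value_le: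
  assumes "w \<in> space M"
  shows "ereal (min_value w) \<le> F z w"
proof -
  obtain xs where xs: "xs \<in> X" using solution_exists by blast
  show ?thesis
    using common_minimizer[OF xs assms]
    by (simp add: subdifferential_def zero_ereal_def[symmetric] value_at_solution[OF xs assms])
qed

text \<open>The minimum is below \<open>a\<close> iff the epigraph meets the open half-space of heights below \<open>a\<close>.\<close>

lemma min_value_measurable: "min_value \<in> borel_measurable M"
proof (subst borel_measurable_iff_less, intro allI)
  fix a
  obtain xs where xs: "xs \<in> X" using solution_exists by blast
  have "min_value w < a \<longleftrightarrow> ereal_epigraph (\<lambda>z. F z w) \<inter> (UNIV \<times> {..<a}) \<noteq> {}" if w: "w \<in> space M" for w
  proof
    assume "min_value w < a"
    then have "(xs, min_value w) \<in> ereal_epigraph (\<lambda>z. F z w) \<inter> (UNIV \<times> {..<a})"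
      by (simp add: ereal_epigraph_def value_at_solution[OF xs w])
    then show "ereal_epigraph (\<lambda>z. F z w) \<inter> (UNIV \<times> {..<a}) \<noteq> {}" by blast
  next
    assume "ereal_epigraph (\<lambda>z. F z w) \<inter> (UNIV \<times> {..<a}) \<noteq> {}"
    then obtain z r where r: "F z w \<le> ereal r" "r < a"
      by (auto simp: ereal_epigraph_def)
    have "ereal (min_value w) \<le> ereal r"
      using min_value_le[OF w] r(1) by (rule order_trans)
    with r(2) show "min_value w < a"
      by simp
  qed
  then have "{w \<in> space M. min_value w < a}
      = {w \<in> space M. ereal_epigraph (\<lambda>z. F z w) \<inter> (UNIV \<times> {..<a}) \<noteq> {}}"
    by blast
  moreover have "open (UNIV \<times> {..<a} :: ('a \<times> real) set)"
    by (intro open_Times open_UNIV open_lessThan)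
  ultimately show "{w \<in> space M. min_value w < a} \<in> sets M"
    using convex_random by (simp add: convex_random_function_def measurable_epigraph_def)
qed

lemma min_value_integrable: "integrable M min_value"
proof -
  obtain xs where xs: "xs \<in> X" using solution_exists by blast
  have "(\<integral>\<^sup>+ w. e2ennreal (F xs w) \<partial>M) = (\<integral>\<^sup>+ w. ennreal (min_value w) \<partial>M)"
    "(\<integral>\<^sup>+ w. e2ennreal (- F xs w) \<partial>M) = (\<integral>\<^sup>+ w. ennreal (- min_value w) \<partial>M)"
    using value_at_solution[OF xs] by (auto intro!: nn_integral_cong)
  then have eq: "expected_fun M F xs
      = enn2ereal (\<integral>\<^sup>+ w. ennreal (min_value w) \<partial>M) - enn2ereal (\<integral>\<^sup>+ w. ennreal (- min_value w) \<partial>M)"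
    by (simp add: expected_fun_def ereal_expectation_def)
  have "expected_fun M F xs \<noteq> \<infinity>" "expected_fun M F xs \<noteq> -\<infinity>"
    using finite_at_solution[OF xs] convex_random
    by (auto simp: convex_random_function_def proper_fun_def)
  then have "(\<integral>\<^sup>+ w. ennreal (min_value w) \<partial>M) \<noteq> \<infinity>" "(\<integral>\<^sup>+ w. ennreal (- min_value w) \<partial>M) \<noteq> \<infinity>"
    unfolding eq
    by (cases "\<integral>\<^sup>+ w. ennreal (min_value w) \<partial>M"; cases "\<integral>\<^sup>+ w. ennreal (- min_value w) \<partial>M"; auto)+
  then show ?thesis
    by (simp add: real_integrable_def min_value_measurable)
qed

text \<open>
  The quadratic growth at \<open>p\<close> is evaluated at solutions. The gap is the same for all of them,
  since a component takes the same value at all its minimizers; so the infimum over solutions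
  can be taken on the right-hand side, while on the left any solution gives an upper bound for
  the distance.
\<close>

lemma
  assumes "\<mu> > 0" and w: "w \<in> space M"
  shows envelope_eq: "moreau_envelope \<mu> (\<lambda>z. F z w) x = ereal (min_value w + envelope_gap \<mu> x w)"
    and envelope_gap_nonneg: "0 \<le> envelope_gap \<mu> x w"
    and infdist_prox: "(infdist (prox \<mu> (\<lambda>z. F z w) x) X)\<^sup>2 + 2 * \<mu> * envelope_gap \<mu> x w
                         \<le> (infdist x X)\<^sup>2"
proof -
  let ?p = "prox \<mu> (\<lambda>z. F z w) x"
  obtain e where e: "moreau_envelope \<mu> (\<lambda>z. F z w) x = ereal e"
    and attained: "F ?p w + ereal ((norm (?p - x))\<^sup>2 / (2 * \<mu>)) = ereal e"
    and growth: "\<And>y r. F y w \<le> ereal r \<Longrightarrow>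
           e + (norm (y - ?p))\<^sup>2 / (2 * \<mu>) \<le> r + (norm (y - x))\<^sup>2 / (2 * \<mu>)"
    using prox_quadratic_growth[OF component_regular[OF w] \<open>\<mu> > 0\<close> min_value_le[OF w], of x] by blast
  have gap: "envelope_gap \<mu> x w = e - min_value w"
    by (simp add: envelope_gap_def e)
  with e show "moreau_envelope \<mu> (\<lambda>z. F z w) x = ereal (min_value w + envelope_gap \<mu> x w)"
    by simp
  have "ereal (min_value w) + 0 \<le> F ?p w + ereal ((norm (?p - x))\<^sup>2 / (2 * \<mu>))"
    using \<open>\<mu> > 0\<close> by (intro add_mono min_value_le w) (auto simp: zero_ereal_def)
  then show gap_nonneg: "0 \<le> envelope_gap \<mu> x w"
    by (simp add: attained gap)
  let ?A = "(infdist ?p X)\<^sup>2 + 2 * \<mu> * envelope_gap \<mu> x w"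
  have "sqrt ?A \<le> dist x xs" if xs: "xs \<in> X" for xs
  proof -
    have "e + (norm (xs - ?p))\<^sup>2 / (2 * \<mu>) \<le> min_value w + (norm (xs - x))\<^sup>2 / (2 * \<mu>)"
      by (rule growth) (simp add: value_at_solution[OF xs w])
    then have "(norm (xs - ?p))\<^sup>2 / (2 * \<mu>) + envelope_gap \<mu> x w \<le> (norm (xs - x))\<^sup>2 / (2 * \<mu>)"
      by (simp add: gap)
    from mult_left_mono[OF this, of "2 * \<mu>"]
    have "(dist ?p xs)\<^sup>2 + 2 * \<mu> * envelope_gap \<mu> x w \<le> (dist x xs)\<^sup>2"
      using \<open>\<mu> > 0\<close> by (simp add: dist_norm norm_minus_commute distrib_left)
    moreover have "(infdist ?p X)\<^sup>2 \<le> (dist ?p xs)\<^sup>2"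
      by (intro power_mono infdist_le xs infdist_nonneg)
    ultimately show ?thesis
      by (intro real_le_lsqrt) auto
  qed
  then have "sqrt ?A \<le> infdist x X"
    using solution_exists by (simp add: infdist_notempty cINF_greatest)
  then show "?A \<le> (infdist x X)\<^sup>2"
    by (rule sqrt_le_D)
qed

lemma envelope_gap_measurable:
  assumes "\<mu> > 0"
  shows "envelope_gap \<mu> x \<in> borel_measurable M"
proof -
  have "(\<lambda>w. min_value w + envelope_gap \<mu> x w) \<in> borel_measurable M"
  proof (subst borel_measurable_iff_less, intro allI)
    fix a
    let ?U = "{p. snd p + (norm (fst p - x))\<^sup>2 / (2 * \<mu>) < a}"
    have "min_value w + envelope_gap \<mu> x w < a \<longleftrightarrow> ereal_epigraph (\<lambda>z. F z w) \<inter> ?U \<noteq> {}"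
      if w: "w \<in> space M" for w
    proof -
      have "min_value w + envelope_gap \<mu> x w < a \<longleftrightarrow> moreau_envelope \<mu> (\<lambda>z. F z w) x < ereal a"
        by (simp add: envelope_eq[OF assms w])
      also have "\<dots> \<longleftrightarrow> ereal_epigraph (\<lambda>z. F z w) \<inter> ?U \<noteq> {}"
        using component_regular(1)[OF w]
        by (subst moreau_envelope_less_iff) (auto simp: proper_fun_def)
      finally show ?thesis .
    qed
    then have "{w \<in> space M. min_value w + envelope_gap \<mu> x w < a}
        = {w \<in> space M. ereal_epigraph (\<lambda>z. F z w) \<inter> ?U \<noteq> {}}"
      by blast
    moreover have "open ?U"
      using assms by (intro open_Collect_less continuous_intros) auto
    ultimately show "{w \<in> space M. min_value w + envelope_gap \<mu> x w < a} \<in> sets M"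
      using convex_random by (simp add: convex_random_function_def measurable_epigraph_def)
  qed
  from borel_measurable_diff[OF this min_value_measurable] show ?thesis
    by simp
qed

lemma envelope_gap_integrable:
  assumes "\<mu> > 0"
  shows "integrable M (envelope_gap \<mu> x)"
proof (rule integrable_const_bound)
  show "AE w in M. norm (envelope_gap \<mu> x w) \<le> (infdist x X)\<^sup>2 / (2 * \<mu>)"
  proof (rule AE_I2)
    fix w assume w: "w \<in> space M"
    have "2 * \<mu> * envelope_gap \<mu> x w \<le> (infdist x X)\<^sup>2"
      using infdist_prox[OF assms w, of x] zero_le_power2[of "infdist (prox \<mu> (\<lambda>z. F z w) x) X"]
      by linarith
    then show "norm (envelope_gap \<mu> x w) \<le> (infdist x X)\<^sup>2 / (2 * \<mu>)"
      using assms envelope_gap_nonneg[OF assms w, of x] by (simp add: field_simps)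
  qed
qed (rule envelope_gap_measurable[OF assms])

lemma expected_envelope_eq:
  assumes "\<mu> > 0"
  shows "expected_envelope M F \<mu> x = ereal (expectation min_value + expectation (envelope_gap \<mu> x))"
  unfolding expected_envelope_def
  using envelope_gap_integrable[OF assms] min_value_integrable
  by (subst ereal_expectation_real[where h = "\<lambda>w. min_value w + envelope_gap \<mu> x w"])
     (auto simp: envelope_eq[OF assms])

text \<open>
  Gaps are nonnegative, so the expected minimum bounds the expected envelope from below at every
  point. Subtracting this bound instead of the infimum only increases the excess.
\<close>

lemma expected_envelope_excess_le:
  assumes "\<mu> > 0"
  shows "expected_envelope M F \<mu> x - (INF z. expected_envelope M F \<mu> z)
           \<le> ereal (expectation (envelope_gap \<mu> x))"
proof -
  have "ereal (expectation min_value) \<le> (INF z. expected_envelope M F \<mu> z)"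
    using envelope_gap_nonneg[OF assms]
    by (intro INF_greatest) (auto simp: expected_envelope_eq[OF assms] intro!: integral_nonneg_AE)
  then have "expected_envelope M F \<mu> x - (INF z. expected_envelope M F \<mu> z)
      \<le> expected_envelope M F \<mu> x - ereal (expectation min_value)"
    by (intro ereal_minus_mono) auto
  then show ?thesis
    by (simp add: expected_envelope_eq[OF assms])
qed

text \<open>
  The second part makes the contraction meaningful: outside the solution set's closure, where the
  distance is positive, it forces \<open>\<mu> * s \<le> 1\<close>. It holds because the expected gap is at most
  \<open>(infdist x X)\<^sup>2 / (2 * \<mu>)\<close>.
\<close>

lemma expected_prox_step:
  assumes "\<mu> > 0"
    and reg: "ereal (s / 2 * (infdist x X)\<^sup>2)
                \<le> expected_envelope M F \<mu> x - (INF z. expected_envelope M F \<mu> z)"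
  shows "(\<integral>\<^sup>+ w. ennreal ((infdist (prox \<mu> (\<lambda>z. F z w) x) X)\<^sup>2) \<partial>M)
           \<le> ennreal ((1 - \<mu> * s) * (infdist x X)\<^sup>2)" (is "?L \<le> _")
    and "0 \<le> (1 - \<mu> * s) * (infdist x X)\<^sup>2"
proof -
  let ?d = "(infdist x X)\<^sup>2" and ?gap = "envelope_gap \<mu> x"
  note int = envelope_gap_integrable[OF assms(1), of x]
  have nonneg: "0 \<le> ?d - 2 * \<mu> * ?gap w" if "w \<in> space M" for w
    using infdist_prox[OF assms(1) that, of x]
      zero_le_power2[of "infdist (prox \<mu> (\<lambda>z. F z w) x) X"] by linarith
  have int': "expectation (\<lambda>w. ?d - 2 * \<mu> * ?gap w) = ?d - 2 * \<mu> * expectation ?gap"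
    using int by (simp add: prob_space)
  have "ereal (s / 2 * ?d) \<le> ereal (expectation ?gap)"
    using reg expected_envelope_excess_le[OF assms(1)] by (rule order_trans)
  then have "\<mu> * (s / 2 * ?d) \<le> \<mu> * expectation ?gap"
    using assms(1) by (intro mult_left_mono) auto
  then have le: "?d - 2 * \<mu> * expectation ?gap \<le> (1 - \<mu> * s) * ?d"
    by (simp add: algebra_simps)
  have "0 \<le> expectation (\<lambda>w. ?d - 2 * \<mu> * ?gap w)"
    using nonneg by (intro integral_nonneg_AE AE_I2)
  with le show "0 \<le> (1 - \<mu> * s) * ?d"
    by (simp add: int')
  have "?L \<le> (\<integral>\<^sup>+ w. ennreal (?d - 2 * \<mu> * ?gap w) \<partial>M)"
    using infdist_prox[OF assms(1), of _ x]
    by (intro nn_integral_mono ennreal_leI) (simp add: le_diff_eq)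
  also have "\<dots> = ennreal (expectation (\<lambda>w. ?d - 2 * \<mu> * ?gap w))"
    using int nonneg by (intro nn_integral_eq_integral) auto
  also have "\<dots> \<le> ennreal ((1 - \<mu> * s) * ?d)"
    using le by (simp add: int' ennreal_leI)
  finally show "?L \<le> ennreal ((1 - \<mu> * s) * ?d)" .
qed

lemma prox_component_measurable:
  assumes "\<mu> > 0"
  shows "(\<lambda>(x, w). prox \<mu> (\<lambda>z. F z w) x) \<in> borel_measurable (borel \<Otimes>\<^sub>M M)"
  using convex_random assms min_value_le
  by (intro prox_measurable) (auto simp: convex_random_function_def)

end

section \<open>The stochastic proximal point iteration\<close>

lemma indep_random_vars_joint_law:
  assumes "prob_space P" and indep: "indep_random_vars P N Y M Z"
  shows "distr P (N \<Otimes>\<^sub>M M) (\<lambda>\<omega>. (Y \<omega>, Z \<omega>)) = distr P N Y \<Otimes>\<^sub>M distr P M Z"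
proof -
  interpret P: prob_space P by fact
  have [measurable]: "Y \<in> measurable P N" "Z \<in> measurable P M"
    using indep by (auto simp: indep_random_vars_def)
  interpret Y: prob_space "distr P N Y" by (rule P.prob_space_distr) simp
  interpret Z: prob_space "distr P M Z" by (rule P.prob_space_distr) simp
  have "distr P N Y \<Otimes>\<^sub>M distr P M Z = distr P (N \<Otimes>\<^sub>M M) (\<lambda>\<omega>. (Y \<omega>, Z \<omega>))"
  proof (rule pair_measure_eqI)
    fix A B assume "A \<in> sets (distr P N Y)" "B \<in> sets (distr P M Z)"
    then have AB [measurable]: "A \<in> sets N" "B \<in> sets M" by auto
    have "P.prob ((Y -` A \<inter> space P) \<inter> (Z -` B \<inter> space P))
        = P.prob (Y -` A \<inter> space P) * P.prob (Z -` B \<inter> space P)"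
      using indep AB unfolding indep_random_vars_def by (intro P.indep_setD) auto
    moreover have "(\<lambda>\<omega>. (Y \<omega>, Z \<omega>)) -` (A \<times> B) \<inter> space P
        = (Y -` A \<inter> space P) \<inter> (Z -` B \<inter> space P)"
      by auto
    ultimately show "emeasure (distr P N Y) A * emeasure (distr P M Z) B
        = emeasure (distr P (N \<Otimes>\<^sub>M M) (\<lambda>\<omega>. (Y \<omega>, Z \<omega>))) (A \<times> B)"
      by (simp add: emeasure_distr P.emeasure_eq_measure ennreal_mult)
  qed (auto intro: Y.sigma_finite_measure_axioms Z.sigma_finite_measure_axioms
       intro!: sets_pair_measure_cong)
  then show ?thesis ..
qed

lemma (in interpolating_family) spp_iterate_function_of_samples:
  assumes "\<mu> > 0" and spp: "spp_sequence P M F \<mu> \<xi> x"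
  shows "\<exists>H \<in> measurable (borel \<Otimes>\<^sub>M PiM {..<k} (\<lambda>_. M)) borel.
           \<forall>\<omega>\<in>space P. x k \<omega> = H (x 0 \<omega>, \<lambda>i\<in>{..<k}. \<xi> i \<omega>)"
proof (induction k)
  case 0
  show ?case by (intro bexI[of _ fst]) auto
next
  case (Suc k)
  then obtain H where [measurable]: "H \<in> measurable (borel \<Otimes>\<^sub>M PiM {..<k} (\<lambda>_. M)) borel"
    and H: "\<And>\<omega>. \<omega> \<in> space P \<Longrightarrow> x k \<omega> = H (x 0 \<omega>, \<lambda>i\<in>{..<k}. \<xi> i \<omega>)"
    by blast
  let ?N = "borel \<Otimes>\<^sub>M PiM {..<Suc k} (\<lambda>_. M)"
  let ?H = "\<lambda>y. (\<lambda>(x, w). prox \<mu> (\<lambda>z. F z w) x) (H (fst y, restrict (snd y) {..<k}), snd y k)"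
  have [measurable]: "(\<lambda>y. restrict (snd y) {..<k}) \<in> measurable ?N (PiM {..<k} (\<lambda>_. M))"
    by (rule measurable_compose[OF measurable_snd measurable_restrict_subset]) auto
  have [measurable]: "(\<lambda>y. snd y k) \<in> measurable ?N M"
    by (rule measurable_compose[OF measurable_snd measurable_component_singleton]) auto
  have "(\<lambda>y. (H (fst y, restrict (snd y) {..<k}), snd y k)) \<in> measurable ?N (borel \<Otimes>\<^sub>M M)"
    by measurable
  from measurable_compose[OF this prox_component_measurable[OF assms(1)]]
  have "?H \<in> measurable ?N borel" .
  then show ?case
  proof (rule bexI[rotated], intro ballI)
    fix \<omega> assume \<omega>: "\<omega> \<in> space P"
    have restrict: "restrict (\<lambda>i\<in>{..<Suc k}. \<xi> i \<omega>) {..<k} = (\<lambda>i\<in>{..<k}. \<xi> i \<omega>)"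
      by (auto simp: restrict_def)
    have "x (Suc k) \<omega> = prox \<mu> (\<lambda>z. F z (\<xi> k \<omega>)) (x k \<omega>)"
      using spp \<omega> by (simp add: spp_sequence_def)
    also have "\<dots> = ?H (x 0 \<omega>, \<lambda>i\<in>{..<Suc k}. \<xi> i \<omega>)"
      unfolding H[OF \<omega>] fst_conv snd_conv prod.case restrict by simp
    finally show "x (Suc k) \<omega> = ?H (x 0 \<omega>, \<lambda>i\<in>{..<Suc k}. \<xi> i \<omega>)" .
  qed
qed

text \<open>
  Independence makes the joint law of the past and the new sample a product, so the sample can be
  integrated first; the inner integral is then bounded at the fixed point \<open>H y\<close>.
\<close>

lemma (in interpolating_family) spp_expected_step:
  assumes "\<mu> > 0" and spp: "spp_sequence P M F \<mu> \<xi> x"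
    and reg: "\<And>y. ereal (s / 2 * (infdist y X)\<^sup>2)
                \<le> expected_envelope M F \<mu> y - (INF z. expected_envelope M F \<mu> z)"
    and "0 \<le> 1 - \<mu> * s"
  shows "(\<integral>\<^sup>+ \<omega>. ennreal ((infdist (x (Suc k) \<omega>) X)\<^sup>2) \<partial>P)
           \<le> ennreal (1 - \<mu> * s) * (\<integral>\<^sup>+ \<omega>. ennreal ((infdist (x k \<omega>) X)\<^sup>2) \<partial>P)"
proof -
  let ?N = "borel \<Otimes>\<^sub>M PiM {..<k} (\<lambda>_. M)" and ?Y = "\<lambda>\<omega>. (x 0 \<omega>, \<lambda>i\<in>{..<k}. \<xi> i \<omega>)"
  let ?prox = "\<lambda>(x, w). prox \<mu> (\<lambda>z. F z w) x"
  let ?d = "\<lambda>y. ennreal ((infdist y X)\<^sup>2)"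
  obtain H where H [measurable]: "H \<in> measurable ?N borel"
    and xH: "\<And>\<omega>. \<omega> \<in> space P \<Longrightarrow> x k \<omega> = H (?Y \<omega>)"
    using spp_iterate_function_of_samples[OF assms(1) spp, of k] by blast
  interpret P: prob_space P
    using spp by (simp add: spp_sequence_def)
  have indep: "indep_random_vars P ?N ?Y M (\<xi> k)" and law: "distr P M (\<xi> k) = M"
    using spp by (auto simp: spp_sequence_def)
  have Y [measurable]: "?Y \<in> measurable P ?N" and \<xi> [measurable]: "\<xi> k \<in> measurable P M"
    using indep by (auto simp: indep_random_vars_def)
  have d [measurable]: "?d \<in> borel_measurable borel"
    by (intro measurable_compose[OF _ measurable_ennreal] borel_measurable_continuous_onI
        continuous_intros)
  have "(\<lambda>p. (H (fst p), snd p)) \<in> measurable (?N \<Otimes>\<^sub>M M) (borel \<Otimes>\<^sub>M M)"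
    by measurable
  from measurable_compose[OF measurable_compose[OF this prox_component_measurable[OF assms(1)]] d]
  have step [measurable]: "(\<lambda>p. ?d (?prox (H (fst p), snd p))) \<in> borel_measurable (?N \<Otimes>\<^sub>M M)"
    by simp
  have "(\<integral>\<^sup>+ \<omega>. ?d (x (Suc k) \<omega>) \<partial>P) = (\<integral>\<^sup>+ \<omega>. ?d (?prox (H (?Y \<omega>), \<xi> k \<omega>)) \<partial>P)"
    using spp xH by (intro nn_integral_cong) (simp add: spp_sequence_def)
  also have "\<dots> = (\<integral>\<^sup>+ p. ?d (?prox (H (fst p), snd p)) \<partial>distr P (?N \<Otimes>\<^sub>M M) (\<lambda>\<omega>. (?Y \<omega>, \<xi> k \<omega>)))"
    using nn_integral_distr[OF measurable_Pair[OF Y \<xi>],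
        of "\<lambda>p. ?d (?prox (H (fst p), snd p))", unfolded measurable_distr_eq1, OF step, symmetric]
    by (simp only: fst_conv snd_conv)
  also have "\<dots> = (\<integral>\<^sup>+ p. ?d (?prox (H (fst p), snd p)) \<partial>(distr P ?N ?Y \<Otimes>\<^sub>M M))"
    by (simp only: indep_random_vars_joint_law[OF P.prob_space_axioms indep] law)
  also have "\<dots> = (\<integral>\<^sup>+ y. \<integral>\<^sup>+ w. ?d (?prox (H y, w)) \<partial>M \<partial>distr P ?N ?Y)"
    using step by (subst nn_integral_fst[symmetric])
      (auto cong: measurable_cong_sets sets_pair_measure_cong)
  also have "\<dots> \<le> (\<integral>\<^sup>+ y. ennreal (1 - \<mu> * s) * ?d (H y) \<partial>distr P ?N ?Y)"
    using expected_prox_step(1)[OF assms(1) reg] \<open>0 \<le> 1 - \<mu> * s\<close>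
    by (intro nn_integral_mono) (simp add: ennreal_mult'[symmetric])
  also have "\<dots> = (\<integral>\<^sup>+ \<omega>. ennreal (1 - \<mu> * s) * ?d (H (?Y \<omega>)) \<partial>P)"
    by (intro nn_integral_distr Y) measurable
  also have "\<dots> = ennreal (1 - \<mu> * s) * (\<integral>\<^sup>+ \<omega>. ?d (H (?Y \<omega>)) \<partial>P)"
    by (intro nn_integral_cmult measurable_compose[OF measurable_compose[OF Y H] d])
  also have "(\<integral>\<^sup>+ \<omega>. ?d (H (?Y \<omega>)) \<partial>P) = (\<integral>\<^sup>+ \<omega>. ?d (x k \<omega>) \<partial>P)"
    using xH by (intro nn_integral_cong) simp
  finally show ?thesis .
qed

theorem corollary4p5:
  fixes M :: "'w measure" and P :: "'p measure"
    and F :: "'a::euclidean_space \<Rightarrow> 'w \<Rightarrow> ereal"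
    and g :: "'a \<Rightarrow> 'w \<Rightarrow> 'a" and S :: real
    and \<sigma> :: "real \<Rightarrow> real" and \<mu> :: real
    and \<xi> :: "nat \<Rightarrow> 'p \<Rightarrow> 'w" and x :: "nat \<Rightarrow> 'p \<Rightarrow> 'a" and k :: nat
  defines "Xopt \<equiv> argmin_set (expected_fun M F)"
  assumes "prob_space M"
    and "convex_random_function M F"
    and "basic_assumptions M F g S"
    and "\<And>m. m > 0 \<Longrightarrow> \<sigma> m > 0"
    and "antimono_on {0<..} \<sigma>"
    and "\<And>m y. m > 0 \<Longrightarrow>
           ereal (\<sigma> m / 2 * (infdist y Xopt)\<^sup>2)
             \<le> expected_envelope M F m y - (INF z. expected_envelope M F m z)"
    and "\<And>xs w. xs \<in> Xopt \<Longrightarrow> w \<in> space M \<Longrightarrow> 0 \<in> subdifferential (\<lambda>z. F z w) xs"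
    and "\<mu> > 0"
    and "spp_sequence P M F \<mu> \<xi> x"
  shows "(\<integral>\<^sup>+ \<omega>. ennreal ((infdist (x k \<omega>) Xopt)\<^sup>2) \<partial>P)
           \<le> ennreal ((1 - \<mu> * \<sigma> \<mu>) ^ k) * (\<integral>\<^sup>+ \<omega>. ennreal ((infdist (x 0 \<omega>) Xopt)\<^sup>2) \<partial>P)"
proof -
  interpret M: prob_space M by fact
  interpret interpolating_family M F Xopt
  proof
    show "Xopt \<noteq> {}"
      using assms(4) by (simp add: basic_assumptions_def Xopt_def)
    fix xs assume "xs \<in> Xopt"
    then have "expected_fun M F xs \<le> expected_fun M F y" for y
      by (auto simp: Xopt_def argmin_set_def is_arg_min_def not_less)
    moreover obtain y where "expected_fun M F y < \<infinity>"
      using assms(3) by (auto simp: convex_random_function_def proper_fun_def less_top)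
    ultimately show "expected_fun M F xs < \<infinity>"
      by (rule le_less_trans)
  qed (use assms(3,8) in auto)
  note reg = assms(7)[OF \<open>\<mu> > 0\<close>]
  let ?\<rho> = "1 - \<mu> * \<sigma> \<mu>"
  show ?thesis
  proof (cases "0 \<le> ?\<rho>")
    case True
    show ?thesis
    proof (induction k)
      case (Suc k)
      have "(\<integral>\<^sup>+ \<omega>. ennreal ((infdist (x (Suc k) \<omega>) Xopt)\<^sup>2) \<partial>P)
          \<le> ennreal ?\<rho> * (\<integral>\<^sup>+ \<omega>. ennreal ((infdist (x k \<omega>) Xopt)\<^sup>2) \<partial>P)"
        by (rule spp_expected_step[OF assms(9,10) reg True])
      also have "\<dots> \<le> ennreal ?\<rho> * (ennreal (?\<rho> ^ k) * (\<integral>\<^sup>+ \<omega>. ennreal ((infdist (x 0 \<omega>) Xopt)\<^sup>2) \<partial>P))"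
        using Suc by (rule mult_left_mono) simp
      also have "\<dots> = ennreal (?\<rho> ^ Suc k) * (\<integral>\<^sup>+ \<omega>. ennreal ((infdist (x 0 \<omega>) Xopt)\<^sup>2) \<partial>P)"
        using True by (simp add: ennreal_mult mult.assoc)
      finally show ?case .
    qed simp
  next
    case False
    \<comment> \<open>A negative factor is compatible with regularity only if no point has positive distance;
      this matters because \<open>ennreal\<close> truncates the odd powers of the factor to \<open>0\<close>.\<close>
    have "infdist y Xopt = 0" for y
      using expected_prox_step(2)[OF assms(9) reg, of y] False
      by (auto simp: zero_le_mult_iff)
    then show ?thesis
      by simp
  qed
qed

end
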